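(* Let $N$ be a positive integer and let $A,B$ be $N\times N$ integer matrices such that all entries of $A$ are non-negative, $A$ has no zero rows and no zero columns, $B_{i,j}=0$ whenever $A_{i,j}=0$, and $|B_{i,j}|<A_{i,j}$ whenever $A_{i,j}\ne0$. Assume that the Katsura--Exel--Pardo groupoid $\mathcal{G}_{A,B}$ is Hausdorff, effective and minimal. Then the self-similar graph $(\mathbb{Z},E_A,\varphi)$ associated to $A$ and $B$ is contracting, i.e. there is a finite subset $\mathcal{N}\subset\mathbb{Z}$ such that for every $m\in\mathbb{Z}$ there is $n\in\mathbb{N}$ with $\varphi(m,\mu)\in\mathcal{N}$ for all finite paths $\mu$ in $E_A$ of length at least $n$.
   Context: Katsura--Exel--Pardo groupoid. $E_A$ is the directed graph with vertex set $E_A^0=\{1,\dots,N\}$ and edge set $E_A^1=\{e_{i,j,n} : 1\le i,j\le N,\ 0\le n<A_{i,j}\}$, where $s(e_{i,j,n})=i$ and $r(e_{i,j,n})=j$. Paths are sequences $e_1e_2\cdots$ of edges with $r(e_k)=s(e_{k+1})$; $E_A^*$ is the set of finite paths (vertices being paths of length $0$), $|\mu|$ the length of $\mu$, and $E_A^\infty$ the space of infinite paths, with topology generated by the cylinder sets $Z(\mu)=\{\mu y : y\in E_A^\infty,\ s(y)=r(\mu)\}$, $\mu \in E_A^*$. For $m\in\mathbb{Z}$ and $e=e_{i,j,n}\in E_A^1$ let $q,r$ be the unique integers with $mB_{i,j}+n=qA_{i,j}+r$ and $0\le r<A_{i,j}$, and set $\kappa_m(e)=e_{i,j,r}$, $\varphi(m,e)=q$.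 For a vertex $v$ put $\kappa_m(v)=v$, $\varphi(m,v)=m$. Extend to finite paths by $\kappa_m(\mu e)=\kappa_m(\mu)\kappa_{\varphi(m,\mu)}(e)$ and $\varphi(m,\mu e)=\varphi(\varphi(m,\mu),e)$, and (by continuing indefinitely) let $\kappa_m$ act on $E_A^\infty$. The self-similar graph $(\mathbb{Z},E_A,\varphi)$ is the graph $E_A$ with the $\mathbb{Z}$-action $\kappa$ and the cocycle $\varphi$. Consider quadruples $(\mu,m,\nu;x)$ with $\mu,\nu\in E_A^*$, $r(\mu)=r(\nu)$, $m\in\mathbb{Z}$, $x\in Z(\nu)$, and the equivalence relation generated by $(\mu,m,\nu;\nu e z)\sim(\mu\kappa_m(e),\varphi(m,e),\nu e;\nu e z)$ ($e\in E_A^1$, $z \in E_A^\infty$). $\mathcal{G}_{A,B}$ is the set of equivalence classes $[\mu,m,\nu;x]$, with $s([\mu,m,\nu;\nu y])=\nu y$, $r([\mu,m,\nu;\nu y])=\mu\kappa_m(y)$ (unit space identified with $E_A^\infty$ via $x\leftrightarrow[s(x),0,s(x);x]$), product determined by $[\lambda,n,\mu;\mu\kappa_m(y)]\cdot[\mu,m,\nu;\nu y]=[\lambda,n+m,\nu;\nu y]$, and inverse $[\mu,m,\nu;\nu y]^{-1}=[\nu,-m,\mu;\mu\kappa_m(y)]$. Its topology has basis $Z(\mu,m,\nu)=\{[\mu,m,\nu;x] : x\in Z(\nu)\}$; it is an ample groupoid. A groupoid is effective if the interior of its isotropy is its unit space, and minimal if every orbit is dense in the unit space. Contracting. In general, a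 self-similar graph $(G,E,\varphi)$ (a group $G$ acting on a graph $E$ with a cocycle $\varphi$ extended to finite paths) is contracting if there is a finite $\mathcal{N}\subset G$ such that for every $g\in G$ there is $n\in\mathbb{N}$ with $\varphi(g,\mu)\in\mathcal{N}$ for all finite paths $\mu$ of length $\ge n$. *)

theory Defs
  imports "HOL-Analysis.Analysis" "HOL-Library.Stream" "Graph_Theory.Arc_Walk"
begin

section \<open>Paths in a directed graph\<close>

text \<open>
  Source and range of an edge are \<^const>\<open>tail\<close> and \<^const>\<open>head\<close>. A finite path is a pair of its source
  and its list of edges, so that the paths of length \<open>0\<close> are exactly the vertices. An infinite path
  is a stream of edges.
\<close>

type_synonym ('v, 'e) fpath = "'v \<times> 'e list"

definition fin_paths :: "('v, 'e) pre_digraph \<Rightarrow> ('v, 'e) fpath set" where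
  "fin_paths E = {(v, p). \<exists>w. pre_digraph.awalk E v p w}"

definition path_range :: "('v, 'e) pre_digraph \<Rightarrow> ('v, 'e) fpath \<Rightarrow> 'v" where
  "path_range E \<mu> = last (pre_digraph.awalk_verts E (fst \<mu>) (snd \<mu>))"

definition path_length :: "('v, 'e) fpath \<Rightarrow> nat" where
  "path_length \<mu> = length (snd \<mu>)"

definition path_snoc :: "('v, 'e) fpath \<Rightarrow> 'e \<Rightarrow> ('v, 'e) fpath" where
  "path_snoc \<mu> e = (fst \<mu>, snd \<mu> @ [e])"

definition inf_paths :: "('v, 'e) pre_digraph \<Rightarrow> 'e stream set" where
  "inf_paths E = {x. \<forall>k. x !! k \<in> arcs E \<and> head E (x !! k) = tail E (x !! Suc k)}"

definition cylinder :: "('v, 'e) pre_digraph \<Rightarrow> ('v, 'e) fpath \<Rightarrow> 'e stream set" where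
  "cylinder E \<mu> = {snd \<mu> @- y | y. y \<in> inf_paths E \<and> tail E (shd y) = path_range E \<mu>}"

definition inf_path_topology :: "('v, 'e) pre_digraph \<Rightarrow> 'e stream topology" where
  "inf_path_topology E = topology_generated_by (cylinder E ` fin_paths E)"

section \<open>Contracting self-similar graphs\<close>

text \<open>
  Being contracting involves the graph and the cocycle (extended to finite paths), but not the action.
\<close>

definition contracting ::
    "('v, 'e) pre_digraph \<Rightarrow> ('g::group_add \<Rightarrow> ('v, 'e) fpath \<Rightarrow> 'g) \<Rightarrow> bool" where
  "contracting E \<phi> \<longleftrightarrow>
     (\<exists>\<N>. finite \<N> \<and> (\<forall>g. \<exists>n. \<forall>\<mu>\<in>fin_paths E. n \<le> path_length \<mu> \<longrightarrow> \<phi> g \<mu> \<in> \<N>))"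

section \<open>Topological groupoids\<close>

text \<open>
  The unit space is a space of objects with its own topology; \<open>gunit\<close> identifies it with a set of
  arrows.
\<close>

record ('x, 'g) top_groupoid =
  gobjs :: "'x topology"
  garrs :: "'g topology"
  gsrc :: "'g \<Rightarrow> 'x"
  grng :: "'g \<Rightarrow> 'x"
  gunit :: "'x \<Rightarrow> 'g"
  gmult :: "'g \<Rightarrow> 'g \<Rightarrow> 'g"
  ginv :: "'g \<Rightarrow> 'g"

definition isotropy :: "('x, 'g) top_groupoid \<Rightarrow> 'g set" where
  "isotropy G = {g \<in> topspace (garrs G). grng G g = gsrc G g}"

definition orbit :: "('x, 'g) top_groupoid \<Rightarrow> 'x \<Rightarrow> 'x set" where
  "orbit G x = grng G ` {g \<in> topspace (garrs G). gsrc G g = x}"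

definition Hausdorff_groupoid :: "('x, 'g) top_groupoid \<Rightarrow> bool" where
  "Hausdorff_groupoid G \<longleftrightarrow> Hausdorff_space (garrs G)"

definition effective_groupoid :: "('x, 'g) top_groupoid \<Rightarrow> bool" where
  "effective_groupoid G \<longleftrightarrow>
     garrs G interior_of isotropy G = gunit G ` topspace (gobjs G)"

definition minimal_groupoid :: "('x, 'g) top_groupoid \<Rightarrow> bool" where
  "minimal_groupoid G \<longleftrightarrow>
     (\<forall>x\<in>topspace (gobjs G). gobjs G closure_of orbit G x = topspace (gobjs G))"

section \<open>The self-similar graph of a pair of integer matrices\<close>

text \<open>
  An \<open>N \<times> N\<close> matrix is indexed by a finite type \<open>'n\<close> with \<open>N\<close> elements, which is also the vertex set.
  The triple \<open>(i, j, n)\<close> is the edge usually written \<open>e\<^bsub>i,j,n\<^esub>\<close>.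
\<close>

type_synonym 'n kep_edge = "'n \<times> 'n \<times> int"
type_synonym 'n kep_path = "('n, 'n kep_edge) fpath"

definition kep_graph :: "int^'n^'n \<Rightarrow> ('n, 'n kep_edge) pre_digraph" where
  "kep_graph A = \<lparr>verts = UNIV, arcs = {(i, j, n). 0 \<le> n \<and> n < A $ i $ j},
                  tail = (\<lambda>(i, j, n). i), head = (\<lambda>(i, j, n). j)\<rparr>"

fun edge_act :: "int^'n^'n \<Rightarrow> int^'n^'n \<Rightarrow> int \<Rightarrow> 'n kep_edge \<Rightarrow> 'n kep_edge" where
  "edge_act A B m (i, j, n) = (i, j, (m * B $ i $ j + n) mod A $ i $ j)"

fun edge_cocycle :: "int^'n^'n \<Rightarrow> int^'n^'n \<Rightarrow> int \<Rightarrow> 'n kep_edge \<Rightarrow> int" where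
  "edge_cocycle A B m (i, j, n) = (m * B $ i $ j + n) div A $ i $ j"

definition kep_cocycle :: "int^'n^'n \<Rightarrow> int^'n^'n \<Rightarrow> int \<Rightarrow> 'n kep_path \<Rightarrow> int" where
  "kep_cocycle A B m \<mu> = foldl (edge_cocycle A B) m (snd \<mu>)"

primcorec kep_act :: "int^'n^'n \<Rightarrow> int^'n^'n \<Rightarrow> int \<Rightarrow> 'n kep_edge stream \<Rightarrow> 'n kep_edge stream" where
  "kep_act A B m x =
     edge_act A B m (shd x) ## kep_act A B (edge_cocycle A B m (shd x)) (stl x)"

text \<open>
  The recursion above peels off the first edge. It agrees with the extension of the action along
  \<open>\<kappa>\<^sub>m(\<mu>e) = \<kappa>\<^sub>m(\<mu>) \<kappa>\<^bsub>\<phi>(m,\<mu>)\<^esub>(e)\<close>: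
\<close>

lemma kep_cocycle_vertex: "kep_cocycle A B m (v, []) = m"
  by (simp add: kep_cocycle_def)

lemma kep_cocycle_snoc:
  "kep_cocycle A B m (path_snoc \<mu> e) = edge_cocycle A B (kep_cocycle A B m \<mu>) e"
  by (simp add: kep_cocycle_def path_snoc_def)

lemma kep_act_snth: "kep_act A B m x !! k = edge_act A B (kep_cocycle A B m (v, stake k x)) (x !! k)"
  by (induction k arbitrary: m x) (simp_all add: kep_cocycle_def)

section \<open>The Katsura--Exel--Pardo groupoid\<close>

type_synonym 'n kep_quad = "'n kep_path \<times> int \<times> 'n kep_path \<times> 'n kep_edge stream"

definition kep_quads :: "int^'n^'n \<Rightarrow> 'n kep_quad set" where
  "kep_quads A = {(\<mu>, m, \<nu>, x). \<mu> \<in> fin_paths (kep_graph A) \<and> \<nu> \<in> fin_paths (kep_graph A) \<and>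
     path_range (kep_graph A) \<mu> = path_range (kep_graph A) \<nu> \<and> x \<in> cylinder (kep_graph A) \<nu>}"

inductive kep_step :: "int^'n^'n \<Rightarrow> int^'n^'n \<Rightarrow> 'n kep_quad \<Rightarrow> 'n kep_quad \<Rightarrow> bool" for A B where
  "(\<mu>, m, \<nu>, snd \<nu> @- e ## z) \<in> kep_quads A \<Longrightarrow>
   kep_step A B (\<mu>, m, \<nu>, snd \<nu> @- e ## z)
     (path_snoc \<mu> (edge_act A B m e), edge_cocycle A B m e, path_snoc \<nu> e, snd \<nu> @- e ## z)"

definition kep_rel :: "int^'n^'n \<Rightarrow> int^'n^'n \<Rightarrow> 'n kep_quad rel" where
  "kep_rel A B = {(a, b). a \<in> kep_quads A \<and> b \<in> kep_quads A \<and> equivclp (kep_step A B) a b}"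

definition kep_class :: "int^'n^'n \<Rightarrow> int^'n^'n \<Rightarrow> 'n kep_quad \<Rightarrow> 'n kep_quad set" where
  "kep_class A B a = kep_rel A B `` {a}"

definition kep_basic_open ::
    "int^'n^'n \<Rightarrow> int^'n^'n \<Rightarrow> 'n kep_path \<Rightarrow> int \<Rightarrow> 'n kep_path \<Rightarrow> 'n kep_quad set set" where
  "kep_basic_open A B \<mu> m \<nu> = {kep_class A B (\<mu>, m, \<nu>, x) | x. x \<in> cylinder (kep_graph A) \<nu>}"

fun quad_src :: "'n kep_quad \<Rightarrow> 'n kep_edge stream" where
  "quad_src (\<mu>, m, \<nu>, x) = x"

text \<open>In a quadruple \<open>(\<mu>, m, \<nu>; \<nu>y)\<close>, the tail \<open>y\<close> is \<open>sdrop (path_length \<nu>) (\<nu>y)\<close>.\<close>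

fun quad_rng :: "int^'n^'n \<Rightarrow> int^'n^'n \<Rightarrow> 'n kep_quad \<Rightarrow> 'n kep_edge stream" where
  "quad_rng A B (\<mu>, m, \<nu>, x) = snd \<mu> @- kep_act A B m (sdrop (path_length \<nu>) x)"

text \<open>
  Source, range, product and inverse are given on representatives: \<^const>\<open>quad_src\<close> and \<^const>\<open>quad_rng\<close>
  are constant on classes, and for composable classes \<open>g\<close>, \<open>h\<close> the set whose image under
  \<^const>\<open>kep_rel\<close> defines \<open>gmult\<close> lies in one class (likewise for \<open>ginv\<close>).
\<close>

definition kep_groupoid ::
    "int^'n^'n \<Rightarrow> int^'n^'n \<Rightarrow> ('n kep_edge stream, 'n kep_quad set) top_groupoid" where
  "kep_groupoid A B =
     \<lparr>gobjs = inf_path_topology (kep_graph A),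
      garrs = topology_generated_by
        {kep_basic_open A B \<mu> m \<nu> | \<mu> m \<nu>.
           \<mu> \<in> fin_paths (kep_graph A) \<and> \<nu> \<in> fin_paths (kep_graph A) \<and>
           path_range (kep_graph A) \<mu> = path_range (kep_graph A) \<nu>},
      gsrc = (\<lambda>g. the_elem (quad_src ` g)),
      grng = (\<lambda>g. the_elem (quad_rng A B ` g)),
      gunit = (\<lambda>x. let v = tail (kep_graph A) (shd x) in kep_class A B ((v, []), 0, (v, []), x)),
      gmult = (\<lambda>g h. kep_rel A B `` {(\<xi>, n + m, \<nu>, x) | \<xi> n \<mu> m \<nu> x.
        (\<xi>, n, \<mu>, quad_rng A B (\<mu>, m, \<nu>, x)) \<in> g \<and> (\<mu>, m, \<nu>, x) \<in> h}),
      ginv = (\<lambda>g. kep_rel A B `` {(\<nu>, - m, \<mu>, quad_rng A B (\<mu>, m, \<nu>, x)) | \<mu> m \<nu> x.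
        (\<mu>, m, \<nu>, x) \<in> g})\<rparr>"

end

theory Submission
  imports Defs
begin

text \<open>
  Division with remainder by \<open>a = A\<^bsub>i,j\<^esub>\<close> turns the bound \<open>\<bar>B\<^bsub>i,j\<^esub>\<bar> \<le> a - 1\<close> into a strict decrease of
  the absolute value of the cocycle at large \<open>m\<close>: the quotient
  \<open>q = \<phi>(m, e\<^bsub>i,j,n\<^esub>) = \<lfloor>(m B\<^bsub>i,j\<^esub> + n) / a\<rfloor>\<close> satisfies \<open>\<bar>q\<bar> \<le> t\<close> as soon as \<open>\<bar>m\<bar> \<le> t + 1\<close> and
  \<open>a \<le> t\<close> (\<open>abs_div_le\<close>). Let \<open>M\<close> be the largest entry of \<open>A\<close>. Every edge of a path lowers the
  bound on the absolute value of the cocycle by one until it reaches \<open>M\<close>, where it stays; so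
  \<open>\<phi>(m, \<mu>)\<close> lies in \<open>{-M..M}\<close> for all paths \<open>\<mu>\<close> of length at least \<open>\<bar>m\<bar>\<close>.
\<close>

lemma abs_div_le:
  fixes a b m n t :: int
  assumes "\<bar>b\<bar> < a" "0 \<le> n" "n < a" "a \<le> t" "\<bar>m\<bar> \<le> t + 1"
  shows "\<bar>(m * b + n) div a\<bar> \<le> t"
proof -
  have "\<bar>m * b\<bar> \<le> (t + 1) * (a - 1)"
    unfolding abs_mult using assms by (intro mult_mono) auto
  also have "\<dots> = t * a - t + a - 1"
    by (simp add: algebra_simps)
  finally have mb: "\<bar>m * b\<bar> \<le> t * a - t + a - 1" .
  have "- t * a \<le> m * b + n"
    using mb assms by (simp add: abs_le_iff)
  then have "- t \<le> (m * b + n) div a"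
    using zdiv_mono1[of "- t * a" "m * b + n" a] nonzero_mult_div_cancel_right[of a "- t"] assms
    by linarith
  moreover have "m * b + n < (t + 1) * a"
    using mb assms by (simp add: algebra_simps abs_le_iff)
  then have "(m * b + n) div a < t + 1"
    using assms by (smt (verit) div_mult_mod_eq mult_right_mono pos_mod_sign)
  ultimately show ?thesis
    by simp
qed

text \<open>The bound drops from \<open>M + length p\<close> to \<open>M\<close>, one unit per edge of \<open>p\<close>.\<close>

lemma abs_foldl_edge_cocycle_le:
  fixes A B :: "int^'n^'n"
  assumes "\<And>i j. A $ i $ j \<noteq> 0 \<Longrightarrow> \<bar>B $ i $ j\<bar> < A $ i $ j"
    and "\<And>i j. A $ i $ j \<le> M"
    and "set p \<subseteq> arcs (kep_graph A)"
    and "\<bar>m\<bar> \<le> M + int (length p)"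
  shows "\<bar>foldl (edge_cocycle A B) m p\<bar> \<le> M"
  using assms(3,4)
proof (induction p arbitrary: m)
  case Nil
  then show ?case by simp
next
  case (Cons e p)
  obtain i j n where e: "e = (i, j, n)"
    by (cases e)
  with Cons.prems(1) have n: "0 \<le> n" "n < A $ i $ j"
    by (auto simp: kep_graph_def)
  have "A $ i $ j \<le> M + int (length p)"
    using assms(2)[of i j] by simp
  then have "\<bar>edge_cocycle A B m e\<bar> \<le> M + int (length p)"
    using abs_div_le[OF assms(1)[of i j] n] Cons.prems(2) n by (simp add: e)
  then show ?case
    using Cons by simp
qed

theorem proposition6p5:
  fixes A B :: "int^'n^'n"
  assumes "\<And>i j. 0 \<le> A $ i $ j"
    and "\<And>i. \<exists>j. A $ i $ j \<noteq> 0"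
    and "\<And>j. \<exists>i. A $ i $ j \<noteq> 0"
    and "\<And>i j. A $ i $ j = 0 \<Longrightarrow> B $ i $ j = 0"
    and "\<And>i j. A $ i $ j \<noteq> 0 \<Longrightarrow> \<bar>B $ i $ j\<bar> < A $ i $ j"
    and "Hausdorff_groupoid (kep_groupoid A B)"
    and "effective_groupoid (kep_groupoid A B)"
    and "minimal_groupoid (kep_groupoid A B)"
  shows "contracting (kep_graph A) (kep_cocycle A B)"
proof -
  define M where "M = Max (range (\<lambda>(i, j). A $ i $ j))"
  have A_le: "A $ i $ j \<le> M" for i j
    unfolding M_def by (rule Max_ge) (auto intro: image_eqI[of _ _ "(i, j)"])
  have M_nonneg: "0 \<le> M"
    using assms(1) A_le order_trans by blast
  have "kep_cocycle A B m \<mu> \<in> {- M..M}"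
    if "\<mu> \<in> fin_paths (kep_graph A)" "nat \<bar>m\<bar> \<le> path_length \<mu>" for m \<mu>
  proof -
    have "set (snd \<mu>) \<subseteq> arcs (kep_graph A)"
      using that(1) by (auto simp: fin_paths_def pre_digraph.awalk_def)
    moreover have "\<bar>m\<bar> \<le> M + int (length (snd \<mu>))"
      using that(2) M_nonneg by (simp add: path_length_def)
    ultimately have "\<bar>kep_cocycle A B m \<mu>\<bar> \<le> M"
      unfolding kep_cocycle_def using abs_foldl_edge_cocycle_le[OF assms(5) A_le] by blast
    then show ?thesis
      by auto
  qed
  then show ?thesis
    unfolding contracting_def by (intro exI[of _ "{- M..M}"]) blast
qed

end
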